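(* Let $G$ be a framework for a $3$-connected matroid $M$, and let $e$ be a loop-edge of $G$ at a vertex $v$ such that the cycle formed by $e$ is not balanced. If $e\in \mathrm{cl}_M(E(G-v))$, then the independent sets of $M$ are exactly the sets $I\subseteq E(G)$ such that $G[I]$ contains no balanced cycle and $G[I]$ contains at most one cycle.
   Context: For a graph $G$ and a vertex $v$, $\mathrm{loops}_G(v)$ denotes the set of loop-edges of $G$ at $v$. Graphs are finite and may have loops and parallel edges; a loop-edge forms a cycle of length one. For a set $X$ of edges, $G[X]$ is the subgraph of $G$ with edge-set $X$ and no isolated vertices. A graph $G$ is a framework for a matroid $M$ if (1) $E(G)=E(M)$; (2) $r_M(E(H))\le |V(H)|$ for each component $H$ of $G$; (3) for each vertex $v$ of $G$, $\mathrm{cl}_M(E(G-v))\subseteq E(G-v)\cup \mathrm{loops}_G(v)$; and (4) for each circuit $C$ of $M$, the subgraph $G[C]$ has at most two components. A cycle $C$ of $G$ is balanced (with respect to $M$) if $E(C)$ is a circuit of $M$. *)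

theory Defs
  imports Main
begin

section \<open>Matroids\<close>

record 'e matroid =
  ground :: "'e set"
  indep :: "'e set \<Rightarrow> bool"

locale matroid =
  fixes M :: "'e matroid"
  assumes finite_ground: "finite (ground M)"
    and indep_subset_ground: "indep M I \<Longrightarrow> I \<subseteq> ground M"
    and indep_empty: "indep M {}"
    and indep_subset: "indep M J \<Longrightarrow> I \<subseteq> J \<Longrightarrow> indep M I"
    and augment: "indep M I \<Longrightarrow> indep M J \<Longrightarrow> card I < card J \<Longrightarrow>
      \<exists>x \<in> J - I. indep M (insert x I)"

definition circuit :: "'e matroid \<Rightarrow> 'e set \<Rightarrow> bool" where
  "circuit M C \<longleftrightarrow> C \<subseteq> ground M \<and> \<not> indep M C \<and> (\<forall>D. D \<subset> C \<longrightarrow> indep M D)"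

definition rank :: "'e matroid \<Rightarrow> 'e set \<Rightarrow> nat" where
  "rank M X = Max {card I | I. I \<subseteq> X \<and> indep M I}"

definition closure :: "'e matroid \<Rightarrow> 'e set \<Rightarrow> 'e set" where
  "closure M X = {x \<in> ground M. rank M (insert x X) = rank M X}"

text \<open>
  The usual condition \<open>r(X) + r(E - X) - r(E) < k\<close>, rearranged to avoid truncated subtraction.
\<close>
definition separation :: "'e matroid \<Rightarrow> nat \<Rightarrow> 'e set \<Rightarrow> bool" where
  "separation M k X \<longleftrightarrow> X \<subseteq> ground M \<and> k \<le> card X \<and> k \<le> card (ground M - X) \<and>
     rank M X + rank M (ground M - X) < rank M (ground M) + k"

text \<open>Tutte connectivity; in particular no lower bound on the size of the ground set is imposed.\<close>
definition connected_matroid :: "nat \<Rightarrow> 'e matroid \<Rightarrow> bool" where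
  "connected_matroid n M \<longleftrightarrow> (\<forall>k X. 1 \<le> k \<and> k < n \<longrightarrow> \<not> separation M k X)"


section \<open>Graphs with loops and parallel edges\<close>

text \<open>\<open>ends G e\<close> is the set of ends of \<open>e\<close>: one vertex for a loop-edge, two otherwise.\<close>
record ('v, 'e) graph =
  verts :: "'v set"
  edges :: "'e set"
  ends :: "'e \<Rightarrow> 'v set"

locale graph =
  fixes G :: "('v, 'e) graph"
  assumes finite_verts: "finite (verts G)"
    and finite_edges: "finite (edges G)"
    and ends_subset: "x \<in> edges G \<Longrightarrow> ends G x \<subseteq> verts G"
    and card_ends: "x \<in> edges G \<Longrightarrow> card (ends G x) = 1 \<or> card (ends G x) = 2"

definition loops :: "('v, 'e) graph \<Rightarrow> 'v \<Rightarrow> 'e set" where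
  "loops G v = {x \<in> edges G. ends G x = {v}}"

definition delete_vertex :: "('v, 'e) graph \<Rightarrow> 'v \<Rightarrow> ('v, 'e) graph" where
  "delete_vertex G v =
     \<lparr>verts = verts G - {v}, edges = {x \<in> edges G. v \<notin> ends G x}, ends = ends G\<rparr>"

definition edge_subgraph :: "('v, 'e) graph \<Rightarrow> 'e set \<Rightarrow> ('v, 'e) graph" where
  "edge_subgraph G X = \<lparr>verts = (\<Union>x\<in>X. ends G x), edges = X, ends = ends G\<rparr>"

text \<open>
  The end maps are required to agree also outside the edge set, so that a subgraph is determined
  by its vertices and edges and subgraphs can be counted by equality of records.
\<close>
definition subgraph :: "('v, 'e) graph \<Rightarrow> ('v, 'e) graph \<Rightarrow> bool" where
  "subgraph H G \<longleftrightarrow> graph H \<and> verts H \<subseteq> verts G \<and> edges H \<subseteq> edges G \<and> ends H = ends G"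

definition adjacent :: "('v, 'e) graph \<Rightarrow> ('v \<times> 'v) set" where
  "adjacent G = {(u, w). \<exists>x \<in> edges G. ends G x = {u, w}}"

definition connected_graph :: "('v, 'e) graph \<Rightarrow> bool" where
  "connected_graph G \<longleftrightarrow>
     verts G \<noteq> {} \<and> (\<forall>u \<in> verts G. \<forall>w \<in> verts G. (u, w) \<in> (adjacent G)\<^sup>*)"

definition component :: "('v, 'e) graph \<Rightarrow> ('v, 'e) graph \<Rightarrow> bool" where
  "component G H \<longleftrightarrow> subgraph H G \<and> connected_graph H \<and>
     (\<forall>K. subgraph K G \<and> connected_graph K \<and> subgraph H K \<longrightarrow> K = H)"

text \<open>A loop-edge contributes two to the degree of its end.\<close>
definition degree :: "('v, 'e) graph \<Rightarrow> 'v \<Rightarrow> nat" where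
  "degree G v = card {x \<in> edges G. v \<in> ends G x} + card (loops G v)"

text \<open>
  Cycles are the connected 2-regular subgraphs; a loop-edge gives a cycle of length one and a pair
  of parallel edges one of length two.
\<close>
definition cycle :: "('v, 'e) graph \<Rightarrow> ('v, 'e) graph \<Rightarrow> bool" where
  "cycle G C \<longleftrightarrow> subgraph C G \<and> connected_graph C \<and> (\<forall>u \<in> verts C. degree C u = 2)"


section \<open>Frameworks\<close>

definition framework :: "('v, 'e) graph \<Rightarrow> 'e matroid \<Rightarrow> bool" where
  "framework G M \<longleftrightarrow>
     edges G = ground M \<and>
     (\<forall>H. component G H \<longrightarrow> rank M (edges H) \<le> card (verts H)) \<and>
     (\<forall>v \<in> verts G. closure M (edges (delete_vertex G v))
        \<subseteq> edges (delete_vertex G v) \<union> loops G v) \<and>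
     (\<forall>C. circuit M C \<longrightarrow> card {H. component (edge_subgraph G C) H} \<le> 2)"

definition balanced_cycle :: "('v, 'e) graph \<Rightarrow> 'e matroid \<Rightarrow> ('v, 'e) graph \<Rightarrow> bool" where
  "balanced_cycle G M C \<longleftrightarrow> cycle G C \<and> circuit M (edges C)"

end

theory Submission
  imports Defs
begin

text \<open>
  Condition (3) says that a non-loop edge at \<open>u\<close> raises the rank of every set of edges avoiding \<open>u\<close>.
  Hence circuits have minimum degree two, and adding the vertices of a connected set one at a time
  raises the rank each time; with condition (2), a set of edges covering a vertex set \<open>W\<close> inside one
  component has rank at most \<open>|W|\<close>. So a dependent set contains a balanced cycle or two cycles,
  and the union of two cycles that meet is dependent.

  For disjoint unbalanced cycles the point is that \<open>e\<close> lies in the closure of every unbalanced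
  cycle \<open>C\<close>; submodularity then makes two of them dependent. By condition (4), \<open>e\<close> is spanned by a
  component \<open>A\<close> of \<open>G - v\<close>. If \<open>C\<close> lies in \<open>A\<close>, growing \<open>C \<union> {e}\<close> to \<open>A\<close> forces \<open>r(C \<union> {e}) = |C|\<close>;
  if \<open>C\<close> lies in another component, the edges meeting \<open>A\<close> (with or without \<open>e\<close>) would give a
  forbidden 1- or 2-separation.
\<close>

section \<open>Matroid rank\<close>

context matroid
begin

lemma finite_indep: "indep M I \<Longrightarrow> finite I"
  using finite_ground finite_subset indep_subset_ground by blast

lemma finite_indep_cards: "finite {card I | I. I \<subseteq> X \<and> indep M I}"
proof -
  have "{card I | I. I \<subseteq> X \<and> indep M I} \<subseteq> card ` Pow (ground M)"
    using indep_subset_ground by blast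
  then show ?thesis
    using finite_ground finite_subset by blast
qed

lemma rank_attained: "\<exists>I. I \<subseteq> X \<and> indep M I \<and> card I = rank M X"
proof -
  have "{card I | I. I \<subseteq> X \<and> indep M I} \<noteq> {}"
    using indep_empty by blast
  from Max_in[OF finite_indep_cards this] show ?thesis
    unfolding rank_def by auto
qed

lemma card_le_rank: "indep M I \<Longrightarrow> I \<subseteq> X \<Longrightarrow> card I \<le> rank M X"
  unfolding rank_def using finite_indep_cards by (intro Max_ge) auto

lemma rank_mono: "X \<subseteq> Y \<Longrightarrow> rank M X \<le> rank M Y"
  using rank_attained[of X] card_le_rank[of _ Y] by (metis order_trans)

lemma rank_le_card: "finite X \<Longrightarrow> rank M X \<le> card X"
  using rank_attained[of X] by (metis card_mono)

lemma rank_indep: "indep M I \<Longrightarrow> rank M I = card I"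
  by (simp add: card_le_rank finite_indep le_antisym rank_le_card)

lemma indep_of_rank:
  assumes "finite X" "card X \<le> rank M X"
  shows "indep M X"
proof -
  obtain I where "I \<subseteq> X" "indep M I" "card I = rank M X"
    using rank_attained by blast
  then show ?thesis
    using assms by (metis card_seteq)
qed

text \<open>Induction on the number of elements still missing: a basis of \<open>X\<close> supplies
  the next one by augmentation.\<close>

lemma extend_to_rank:
  assumes "indep M I" "I \<subseteq> X"
  shows "\<exists>J. I \<subseteq> J \<and> J \<subseteq> X \<and> indep M J \<and> card J = rank M X"
  using assms
proof (induction "rank M X - card I" arbitrary: I)
  case 0
  then show ?case
    using card_le_rank by (metis diff_is_0_eq order.antisym order.refl)
next
  case (Suc n)
  obtain B where B: "B \<subseteq> X" "indep M B" "card B = rank M X"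
    using rank_attained by blast
  then obtain x where x: "x \<in> B - I" "indep M (insert x I)"
    using augment[of I B] Suc by force
  have "card (insert x I) = Suc (card I)"
    using x finite_indep Suc.prems by (auto simp: card_insert_if)
  then have "\<exists>J. insert x I \<subseteq> J \<and> J \<subseteq> X \<and> indep M J \<and> card J = rank M X"
    using Suc.hyps x B Suc.prems by (intro Suc.hyps(1)) auto
  then show ?case by blast
qed

text \<open>A basis \<open>I\<close> of the intersection extends to a basis \<open>J\<close> of the
  union. Counting \<open>J\<close> within \<open>X\<close> and within \<open>Y\<close> counts
  \<open>J \<inter> X \<inter> Y\<close>, which contains \<open>I\<close>, twice.\<close>

lemma rank_submodular:
  "rank M (X \<union> Y) + rank M (X \<inter> Y) \<le> rank M X + rank M Y"
proof -
  obtain I where I: "I \<subseteq> X \<inter> Y" "indep M I" "card I = rank M (X \<inter> Y)"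
    using rank_attained by blast
  then obtain J where J: "I \<subseteq> J" "J \<subseteq> X \<union> Y" "indep M J" "card J = rank M (X \<union> Y)"
    using extend_to_rank[of I "X \<union> Y"] by blast
  have fin: "finite J" using J finite_indep by blast
  have "card J + card I \<le> card ((J \<inter> X) \<union> (J \<inter> Y)) + card ((J \<inter> X) \<inter> (J \<inter> Y))"
    using I J fin by (intro add_mono card_mono) auto
  also have "\<dots> = card (J \<inter> X) + card (J \<inter> Y)"
    using fin by (metis card_Un_Int finite_Int)
  also have "\<dots> \<le> rank M X + rank M Y"
    using J(3) by (intro add_mono card_le_rank) (auto intro: indep_subset)
  finally show ?thesis using I J by simp
qed

lemma rank_insert_le: "rank M (insert x X) \<le> Suc (rank M X)"
proof -
  have "rank M (insert x X) \<le> rank M {x} + rank M X"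
    using rank_submodular[of "{x}" X] by simp
  then show ?thesis using rank_le_card[of "{x}"] by simp
qed

section \<open>Closure and circuits\<close>

lemma closure_mono:
  assumes "X \<subseteq> Y"
  shows "closure M X \<subseteq> closure M Y"
proof
  fix x assume x: "x \<in> closure M X"
  show "x \<in> closure M Y"
  proof (cases "x \<in> Y")
    case True
    then show ?thesis using x by (simp add: closure_def insert_absorb)
  next
    case False
    \<comment> \<open>These are the union and intersection to which submodularity is applied: the
      gain of \<open>x\<close> over \<open>Y\<close> is at most its gain over
      \<open>X\<close>.\<close>
    then have "insert x X \<union> Y = insert x Y" "insert x X \<inter> Y = X"
      using assms by auto
    then have "rank M (insert x Y) \<le> rank M Y"
      using rank_submodular[of "insert x X" Y] x by (simp add: closure_def)
    then show ?thesis
      using x rank_mono[of Y "insert x Y", OF subset_insertI] by (auto simp: closure_def)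
  qed
qed

lemma rank_insert_not_closure:
  "x \<in> ground M \<Longrightarrow> x \<notin> closure M X \<Longrightarrow> rank M (insert x X) = Suc (rank M X)"
  using rank_insert_le[of x X] rank_mono[of X "insert x X", OF subset_insertI]
  by (auto simp: closure_def)

lemma dependent_contains_circuit:
  assumes "X \<subseteq> ground M" "\<not> indep M X"
  shows "\<exists>C \<subseteq> X. circuit M C"
proof -
  have "finite X" using assms finite_ground finite_subset by blast
  then show ?thesis using assms
  proof (induction X rule: finite_psubset_induct)
    case (psubset X)
    show ?case
    proof (cases "\<forall>D. D \<subset> X \<longrightarrow> indep M D")
      case True
      then show ?thesis using psubset.prems by (auto simp: circuit_def)
    next
      case False
      then obtain D where D: "D \<subset> X" "\<not> indep M D" by blast
      then have "\<exists>C \<subseteq> D. circuit M C" using psubset.prems by (intro psubset.IH) auto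
      then show ?thesis using D by blast
    qed
  qed
qed

lemma circuit_in_closure:
  assumes "circuit M C" "x \<in> C"
  shows "x \<in> closure M (C - {x})"
proof -
  have fin: "finite C" and dep: "\<not> indep M C" and ind: "indep M (C - {x})"
    using assms finite_ground finite_subset by (auto simp: circuit_def)
  have "rank M C < card C"
    using indep_of_rank[OF fin] dep by linarith
  moreover have "rank M (C - {x}) = card C - 1"
    using rank_indep[OF ind] assms(2) fin by simp
  moreover have "rank M (C - {x}) \<le> rank M C" by (rule rank_mono) auto
  ultimately show ?thesis
    using assms by (auto simp: closure_def insert_absorb circuit_def)
qed

text \<open>Adding \<open>x\<close> to a basis \<open>B\<close> of \<open>X\<close> creates a
  dependent set; since \<open>B\<close> is independent, every circuit in it uses
  \<open>x\<close>.\<close>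

lemma closure_contains_circuit:
  assumes "x \<in> closure M X" "x \<notin> X"
  shows "\<exists>C \<subseteq> insert x X. x \<in> C \<and> circuit M C"
proof -
  obtain B where B: "B \<subseteq> X" "indep M B" "card B = rank M X"
    using rank_attained by blast
  have "\<not> indep M (insert x B)"
  proof
    assume "indep M (insert x B)"
    then have "card (insert x B) \<le> rank M (insert x X)"
      using B by (intro card_le_rank) auto
    then show False
      using assms B finite_indep[of B] by (auto simp: closure_def card_insert_if split: if_splits)
  qed
  moreover have "insert x B \<subseteq> ground M"
    using B(2) assms(1) indep_subset_ground[of B] by (simp add: closure_def)
  ultimately obtain C where C: "C \<subseteq> insert x B" "circuit M C"
    using dependent_contains_circuit[of "insert x B"] by blast
  moreover have "x \<in> C"
  proof (rule ccontr)
    assume "x \<notin> C"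
    then have "C \<subseteq> B" using C by blast
    then show False using C B indep_subset by (auto simp: circuit_def)
  qed
  ultimately show ?thesis using B by blast
qed

end


section \<open>Cycles and counting\<close>

definition (in graph) covered :: "'e set \<Rightarrow> 'v set" where
  "covered X = (\<Union>x\<in>X. ends G x)"

definition (in graph) inside :: "'v set \<Rightarrow> 'e set" where
  "inside W = {x \<in> edges G. ends G x \<subseteq> W}"

text \<open>Cycles are handled through their edge sets, so that they can be compared with circuits
  and counted; \<open>cycle_edge_subgraph\<close> justifies this.\<close>

definition (in graph) polygon :: "'e set \<Rightarrow> bool" where
  "polygon K \<longleftrightarrow> cycle G (edge_subgraph G K)"

text \<open>For a vertex \<open>u\<close> of \<open>H\<close> this is the vertex set of its
  component. By reflexivity it contains \<open>u\<close> even when \<open>u\<close> is not a vertex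
  of \<open>H\<close>.\<close>

definition reachable :: "('v, 'e) graph \<Rightarrow> 'v \<Rightarrow> 'v set" where
  "reachable H u = {w. (u, w) \<in> (adjacent H)\<^sup>*}"

lemma edge_subgraph_sel [simp]:
  "edges (edge_subgraph G X) = X" "ends (edge_subgraph G X) = ends G"
  by (simp_all add: edge_subgraph_def)

lemma delete_vertex_sel [simp]:
  "verts (delete_vertex G v) = verts G - {v}"
  "edges (delete_vertex G v) = {x \<in> edges G. v \<notin> ends G x}"
  "ends (delete_vertex G v) = ends G"
  by (simp_all add: delete_vertex_def)

section \<open>Reachability and edges leaving a vertex set\<close>

lemma adjacent_sym: "(u, w) \<in> (adjacent H)\<^sup>* \<Longrightarrow> (w, u) \<in> (adjacent H)\<^sup>*"
proof -
  have "sym (adjacent H)"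
    by (auto simp: sym_def adjacent_def insert_commute)
  then show "(u, w) \<in> (adjacent H)\<^sup>* \<Longrightarrow> (w, u) \<in> (adjacent H)\<^sup>*"
    by (meson symD sym_rtrancl)
qed

lemma reachable_self [simp]: "u \<in> reachable H u"
  by (simp add: reachable_def)

lemma reachable_crossing:
  assumes "s \<in> T" "(s, a) \<in> (adjacent H)\<^sup>*" "a \<notin> T"
  shows "\<exists>x \<in> edges H. \<exists>t b. t \<in> T \<and> b \<notin> T \<and> ends H x = {t, b} \<and> (s, t) \<in> (adjacent H)\<^sup>*
    \<and> (s, b) \<in> (adjacent H)\<^sup>*"
  using assms(2,3)
proof (induction rule: rtrancl_induct)
  case base
  then show ?case using assms by blast
next
  case (step y z)
  show ?case
  proof (cases "y \<in> T")
    case True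
    from step.hyps obtain x where "x \<in> edges H" "ends H x = {y, z}"
      by (auto simp: adjacent_def)
    then show ?thesis using True step.hyps step.prems by (meson rtrancl.rtrancl_into_rtrancl)
  qed (use step in blast)
qed

text \<open>Provides the edges along which \<open>rank_growth\<close> proceeds: a component that
  \<open>T\<close> meets but does not contain has an edge leaving \<open>T\<close>.\<close>

lemma reachable_crossing_pair:
  assumes "t \<in> reachable H u" "a \<in> reachable H u" "t \<in> T" "a \<notin> T"
  shows "\<exists>x \<in> edges H. ends H x \<subseteq> reachable H u
    \<and> (\<exists>s \<in> T. \<exists>b \<in> reachable H u - T. ends H x = {s, b})"
proof -
  have "(t, a) \<in> (adjacent H)\<^sup>*"
    using assms(1,2) adjacent_sym rtrancl_trans unfolding reachable_def by fast
  from reachable_crossing[OF assms(3) this assms(4)]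
  obtain x s b where x: "x \<in> edges H" "s \<in> T" "b \<notin> T" "ends H x = {s, b}"
    "(t, s) \<in> (adjacent H)\<^sup>*" "(t, b) \<in> (adjacent H)\<^sup>*" by blast
  have "s \<in> reachable H u" "b \<in> reachable H u"
    using x assms(1) by (auto simp: reachable_def)
  then show ?thesis using x by (intro bexI[of _ x]) auto
qed

lemma reachable_delete_vertex_subset: "reachable (delete_vertex G v) a \<subseteq> reachable G a"
proof -
  have "(adjacent (delete_vertex G v))\<^sup>* \<subseteq> (adjacent G)\<^sup>*"
    by (intro rtrancl_mono) (auto simp: adjacent_def)
  then show ?thesis by (auto simp: reachable_def)
qed

context graph
begin

lemma edge_ends_cases:
  assumes "x \<in> edges G"
  obtains u where "ends G x = {u}" | u w where "u \<noteq> w" "ends G x = {u, w}"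
  using card_ends[OF assms] by (auto simp: card_1_singleton_iff card_2_iff)

lemma ends_eq_pair:
  assumes "x \<in> edges G" "a \<noteq> b" "a \<in> ends G x" "b \<in> ends G x"
  shows "ends G x = {a, b}"
  using assms(1) by (rule edge_ends_cases) (use assms in auto)

lemma ends_nonempty: "x \<in> edges G \<Longrightarrow> ends G x \<noteq> {}"
  using card_ends by fastforce

lemma covered_subset: "X \<subseteq> edges G \<Longrightarrow> covered X \<subseteq> verts G"
  using ends_subset by (auto simp: covered_def)

lemma finite_edge_set: "X \<subseteq> edges G \<Longrightarrow> finite X"
  using finite_edges finite_subset by blast

lemma finite_covered: "X \<subseteq> edges G \<Longrightarrow> finite (covered X)"
  by (rule finite_subset[OF covered_subset finite_verts])

lemma covered_mono: "X \<subseteq> Y \<Longrightarrow> covered X \<subseteq> covered Y"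
  by (auto simp: covered_def)

lemma covered_Un: "covered (X \<union> Y) = covered X \<union> covered Y"
  by (auto simp: covered_def)

lemma covered_eq_empty: "X \<subseteq> edges G \<Longrightarrow> covered X = {} \<longleftrightarrow> X = {}"
  using ends_nonempty by (fastforce simp: covered_def)

lemma verts_edge_subgraph [simp]: "verts (edge_subgraph G X) = covered X"
  by (simp add: edge_subgraph_def covered_def)

lemma subset_inside_covered: "X \<subseteq> edges G \<Longrightarrow> X \<subseteq> inside (covered X)"
  by (auto simp: inside_def covered_def)

lemma graph_edge_subgraph: "X \<subseteq> edges G \<Longrightarrow> graph (edge_subgraph G X)"
  using finite_covered[of X] finite_edge_set[of X] card_ends
  by unfold_locales (auto simp: covered_def)

lemma subgraph_edge_subgraph: "X \<subseteq> edges G \<Longrightarrow> subgraph (edge_subgraph G X) G"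
  by (simp add: covered_subset graph_edge_subgraph subgraph_def)

section \<open>Degrees and double counting\<close>

lemma degree_sum:
  assumes "X \<subseteq> edges G"
  shows "(\<Sum>u\<in>covered X. degree (edge_subgraph G X) u) = 2 * card X"
proof -
  have fin: "finite X" "finite (covered X)"
    using assms finite_edge_set finite_covered by auto
  have deg: "degree (edge_subgraph G X) u =
      (\<Sum>x\<in>X. (if u \<in> ends G x then 1 else 0) + (if ends G x = {u} then 1 else 0))" for u
    using fin by (simp add: degree_def loops_def sum.distrib sum.If_cases Int_def)
  \<comment> \<open>Each edge contributes two: a non-loop once at each end, a loop-edge twice at its
    only end.\<close>
  have edge: "(\<Sum>u\<in>covered X. (if u \<in> ends G x then 1 else 0) + (if ends G x = {u} then 1 else 0))
      = (2::nat)" if "x \<in> X" for x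
  proof -
    have sub: "ends G x \<subseteq> covered X" using that by (auto simp: covered_def)
    have *: "{u \<in> covered X. u \<in> ends G x} = ends G x" using sub by blast
    have "card (ends G x) + card {u \<in> covered X. ends G x = {u}} = 2"
    proof (rule edge_ends_cases[OF subsetD[OF assms that]])
      fix a assume a: "ends G x = {a}"
      then have "{u \<in> covered X. ends G x = {u}} = {a}" using sub by auto
      then show ?thesis using a by simp
    next
      fix a b assume ab: "a \<noteq> b" "ends G x = {a, b}"
      then have "{u \<in> covered X. ends G x = {u}} = {}" by (auto simp: doubleton_eq_iff)
      then show ?thesis using ab by simp
    qed
    then show ?thesis
      using fin * by (simp add: sum.distrib sum.If_cases Int_def)
  qed
  have "(\<Sum>u\<in>covered X. degree (edge_subgraph G X) u) = (\<Sum>x\<in>X. 2)"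
    unfolding deg by (subst sum.swap) (use edge in simp)
  then show ?thesis by simp
qed

lemma degree_mono:
  assumes "X \<subseteq> Y" "Y \<subseteq> edges G"
  shows "degree (edge_subgraph G X) u \<le> degree (edge_subgraph G Y) u"
  using assms finite_edge_set[of Y] unfolding degree_def loops_def
  by (intro add_mono card_mono) (auto intro: finite_subset)

text \<open>Both counts in the degree are monotone in the edge set, so if their sum does not grow
  from \<open>X\<close> to \<open>Y\<close>, neither does the number of incident edges.\<close>

lemma degree_eq_imp_incident_eq:
  assumes "X \<subseteq> Y" "Y \<subseteq> edges G"
    and "degree (edge_subgraph G Y) u \<le> degree (edge_subgraph G X) u"
    and "y \<in> Y" "u \<in> ends G y"
  shows "y \<in> X"
proof -
  have fin: "finite {x \<in> Y. u \<in> ends G x}" "finite {x \<in> Y. ends G x = {u}}"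
    using assms finite_edge_set[of Y] by (auto intro: finite_subset)
  have "card {x \<in> X. ends G x = {u}} \<le> card {x \<in> Y. ends G x = {u}}"
    using assms fin by (intro card_mono) auto
  then have "card {x \<in> Y. u \<in> ends G x} \<le> card {x \<in> X. u \<in> ends G x}"
    using assms(3) unfolding degree_def loops_def by simp
  then have "{x \<in> X. u \<in> ends G x} = {x \<in> Y. u \<in> ends G x}"
    using assms fin by (intro card_seteq) auto
  then show ?thesis using assms by blast
qed

section \<open>Polygons, sparse sets and dense sets\<close>

lemma polygonD:
  assumes "polygon K"
  shows "K \<subseteq> edges G" "K \<noteq> {}" "\<And>u. u \<in> covered K \<Longrightarrow> degree (edge_subgraph G K) u = 2"
    "\<And>u w. u \<in> covered K \<Longrightarrow> w \<in> covered K \<Longrightarrow> (u, w) \<in> (adjacent (edge_subgraph G K))\<^sup>*"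
proof -
  have "subgraph (edge_subgraph G K) G" and conn: "connected_graph (edge_subgraph G K)"
    and deg: "\<forall>u \<in> covered K. degree (edge_subgraph G K) u = 2"
    using assms by (simp_all add: polygon_def cycle_def)
  then show "K \<subseteq> edges G" by (simp add: subgraph_def)
  show "K \<noteq> {}" using conn by (auto simp: connected_graph_def covered_def)
  show "degree (edge_subgraph G K) u = 2" if "u \<in> covered K" for u
    using deg that by blast
  show "(u, w) \<in> (adjacent (edge_subgraph G K))\<^sup>*" if "u \<in> covered K" "w \<in> covered K" for u w
    using conn that by (simp add: connected_graph_def)
qed

lemma polygon_card:
  assumes "polygon K"
  shows "card K = card (covered K)"
  using degree_sum[of K] polygonD[OF assms] by simp

text \<open>Proper nonempty subsets of a cycle are forests. If \<open>Z\<close> had as many edges as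
  vertices, its degrees, all at most two, would all equal two; then no edge of \<open>K - Z\<close>
  would touch \<open>Z\<close>, and connectedness of \<open>K\<close> would give
  \<open>Z = K\<close>.\<close>

lemma polygon_proper_subset:
  assumes "polygon K" "Z \<subset> K" "Z \<noteq> {}"
  shows "card Z < card (covered Z)"
proof (rule ccontr)
  assume neg: "\<not> card Z < card (covered Z)"
  have Z: "Z \<subseteq> edges G" and sub: "covered Z \<subseteq> covered K"
    using assms polygonD(1) by (auto simp: covered_def)
  have le: "degree (edge_subgraph G Z) u \<le> 2" if "u \<in> covered Z" for u
    using degree_mono[of Z K u] polygonD(1,3)[OF assms(1)] assms that sub by fastforce
  have eq: "degree (edge_subgraph G Z) u = 2" if u: "u \<in> covered Z" for u
  proof (rule ccontr)
    assume "degree (edge_subgraph G Z) u \<noteq> 2"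
    then have "degree (edge_subgraph G Z) u < 2" using le[OF u] by simp
    then have "(\<Sum>u\<in>covered Z. degree (edge_subgraph G Z) u) < (\<Sum>u\<in>covered Z. 2)"
      using le u finite_covered[OF Z] by (intro sum_strict_mono_ex1) auto
    then show False using degree_sum[OF Z] neg by simp
  qed
  have closed: "y \<in> Z" if "y \<in> K" "u \<in> ends G y" "u \<in> covered Z" for y u
    using that assms polygonD[OF assms(1)] sub
    by (intro degree_eq_imp_incident_eq[of Z K u y]) (auto simp: eq)
  have "covered K \<subseteq> covered Z"
  proof (rule ccontr)
    assume "\<not> covered K \<subseteq> covered Z"
    then obtain a where a: "a \<in> covered K" "a \<notin> covered Z" by blast
    obtain t where t: "t \<in> covered Z" using assms(3) covered_eq_empty[OF Z] by blast
    obtain x s b where "x \<in> K" "s \<in> covered Z" "b \<notin> covered Z" "ends G x = {s, b}"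
      using reachable_crossing[OF t polygonD(4)[OF assms(1), of t a] a(2)] t sub a by auto
    then show False using closed[of x s] by (auto simp: covered_def)
  qed
  then have "K \<subseteq> Z"
    using closed ends_nonempty polygonD(1)[OF assms(1)] by (fastforce simp: covered_def)
  then show False using assms by blast
qed

text \<open>Inclusion-exclusion: each polygon has as many edges as vertices, while
  \<open>C \<inter> D\<close>, empty or a proper subset of \<open>C\<close>, has fewer edges than
  there are common vertices.\<close>

lemma intersecting_polygons:
  assumes "polygon C" "polygon D" "C \<noteq> D" "covered C \<inter> covered D \<noteq> {}"
  shows "card (covered (C \<union> D)) < card (C \<union> D)"
proof -
  have sub: "C \<subseteq> edges G" "D \<subseteq> edges G" using assms polygonD(1) by auto
  note fin = finite_edge_set[OF sub(1)] finite_edge_set[OF sub(2)]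
    finite_covered[OF sub(1)] finite_covered[OF sub(2)]
  have proper: "C \<inter> D \<noteq> C"
  proof
    assume "C \<inter> D = C"
    then have "C \<subset> D" using assms(3) by blast
    then show False
      using polygon_proper_subset[OF assms(2), of C] polygonD(2)[OF assms(1)]
        polygon_card[OF assms(1)] by simp
  qed
  have "card (C \<inter> D) < card (covered C \<inter> covered D)"
  proof (cases "C \<inter> D = {}")
    case True
    then show ?thesis using assms(4) fin by (simp add: card_gt_0_iff)
  next
    case False
    then have "card (C \<inter> D) < card (covered (C \<inter> D))"
      using proper polygon_proper_subset[OF assms(1)] by blast
    also have "\<dots> \<le> card (covered C \<inter> covered D)"
      using fin by (intro card_mono) (auto simp: covered_def)
    finally show ?thesis .
  qed
  then show ?thesis
    using card_Un_Int[of C D] card_Un_Int[of "covered C" "covered D"] fin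
      polygon_card[OF assms(1)] polygon_card[OF assms(2)] by (simp add: covered_Un)
qed

text \<open>Deleting one edge shows that \<open>Y\<close> has at most as many edges as vertices.
  Degrees are at least two, as an edge at a vertex of degree one could be deleted without losing
  density; by the degree sum they are exactly two. A disconnected \<open>Y\<close> would split into
  two sparse sets and be sparse.\<close>

lemma minimal_dense_polygon:
  assumes sub: "Y \<subseteq> edges G" and ne: "Y \<noteq> {}" and dense: "card (covered Y) \<le> card Y"
    and min: "\<And>Z. Z \<subset> Y \<Longrightarrow> Z \<noteq> {} \<Longrightarrow> card Z < card (covered Z)"
  shows "polygon Y"
proof -
  note fin = finite_edge_set[OF sub] finite_covered[OF sub]
  have pos: "1 \<le> card (covered Y)"
    using covered_eq_empty[OF sub] ne fin by (simp add: Suc_leI card_gt_0_iff)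
  have le: "card Y \<le> card (covered Y)"
  proof -
    obtain y where y: "y \<in> Y" using ne by blast
    show ?thesis
    proof (cases "Y - {y} = {}")
      case True
      then have "Y = {y}" using y by blast
      then show ?thesis using pos by simp
    next
      case False
      then have "card (Y - {y}) < card (covered (Y - {y}))" using y by (intro min) auto
      also have "\<dots> \<le> card (covered Y)" using fin by (intro card_mono covered_mono) auto
      finally show ?thesis using y fin by simp
    qed
  qed
  have deg_ge: "2 \<le> degree (edge_subgraph G Y) u" if u: "u \<in> covered Y" for u
  proof (rule ccontr)
    assume neg: "\<not> 2 \<le> degree (edge_subgraph G Y) u"
    obtain y where y: "y \<in> Y" "u \<in> ends G y" using u by (auto simp: covered_def)
    have finy: "finite {x \<in> Y. u \<in> ends G x}" "finite {x \<in> Y. ends G x = {u}}"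
      using fin by auto
    have "card {x \<in> Y. u \<in> ends G x} \<ge> card {y}"
      using finy y by (intro card_mono) auto
    \<comment> \<open>The edge \<open>y\<close> already accounts for degree one, which leaves room
      neither for another edge at \<open>u\<close> nor for a loop-edge there.\<close>
    with neg have c: "card {x \<in> Y. u \<in> ends G x} = 1" "card {x \<in> Y. ends G x = {u}} = 0"
      by (auto simp: degree_def loops_def)
    have only: "{x \<in> Y. u \<in> ends G x} = {y}"
      using c(1) y by (metis (mono_tags, lifting) card_1_singletonE mem_Collect_eq singletonD)
    have noloop: "ends G y \<noteq> {u}" using c(2) finy y by auto
    have "covered (Y - {y}) \<subseteq> covered Y - {u}" using only by (auto simp: covered_def)
    then have "card (covered (Y - {y})) \<le> card (covered Y - {u})"
      using fin by (intro card_mono) auto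
    also have "\<dots> = card (covered Y) - 1" using u fin by simp
    also have "\<dots> \<le> card (Y - {y})" using dense y fin by simp
    \<comment> \<open>Deleting \<open>y\<close> loses one edge and at least the vertex
      \<open>u\<close>, so the rest is still dense and minimality makes it empty. Density of
      \<open>{y}\<close> then forces \<open>y\<close> to be a loop-edge.\<close>
    finally have "Y - {y} = {}" using min[of "Y - {y}"] y by force
    then have "Y = {y}" using y by blast
    then have "card (ends G y) \<le> 1" using dense by (simp add: covered_def)
    then have "card (ends G y) = 1" using card_ends sub y by fastforce
    then show False using noloop y by (metis card_1_singletonE singletonD)
  qed
  have deg: "degree (edge_subgraph G Y) u = 2" if u: "u \<in> covered Y" for u
  proof (rule ccontr)
    assume "degree (edge_subgraph G Y) u \<noteq> 2"
    then have "2 < degree (edge_subgraph G Y) u" using deg_ge[OF u] by simp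
    then have "(\<Sum>u\<in>covered Y. 2) < (\<Sum>u\<in>covered Y. degree (edge_subgraph G Y) u)"
      using deg_ge u fin by (intro sum_strict_mono_ex1) auto
    then show False using degree_sum[OF sub] le by simp
  qed
  have conn: "(u, w) \<in> (adjacent (edge_subgraph G Y))\<^sup>*"
    if u: "u \<in> covered Y" and w: "w \<in> covered Y" for u w
  proof (rule ccontr)
    assume neg: "(u, w) \<notin> (adjacent (edge_subgraph G Y))\<^sup>*"
    let ?R = "reachable (edge_subgraph G Y) u"
    \<comment> \<open>\<open>P\<close> is the part of \<open>Y\<close> in the component of
      \<open>u\<close>. Both \<open>P\<close> and \<open>Y - P\<close> are nonempty and share no
      vertex, so their edge and vertex counts add up.\<close>
    define P where "P = {y \<in> Y. ends G y \<subseteq> ?R}"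
    have touch: "y \<in> P" if "y \<in> Y" "a \<in> ends G y" "a \<in> ?R" for y a
    proof -
      have "b \<in> ?R" if b: "b \<in> ends G y" for b
      proof (cases "a = b")
        case False
        then have "ends G y = {a, b}"
          using \<open>y \<in> Y\<close> \<open>a \<in> ends G y\<close> b sub by (intro ends_eq_pair) auto
        then have "(a, b) \<in> adjacent (edge_subgraph G Y)"
          using \<open>y \<in> Y\<close> by (auto simp: adjacent_def)
        then show ?thesis using \<open>a \<in> ?R\<close> by (auto simp: reachable_def)
      qed (use \<open>a \<in> ?R\<close> in simp)
      then show ?thesis using \<open>y \<in> Y\<close> by (auto simp: P_def)
    qed
    obtain p where p: "p \<in> Y" "u \<in> ends G p" using u by (auto simp: covered_def)
    have pP: "p \<in> P" using touch[OF p] by simp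
    obtain q where q: "q \<in> Y" "w \<in> ends G q" using w by (auto simp: covered_def)
    have qP: "q \<notin> P" using q neg by (auto simp: P_def reachable_def)
    have disj: "covered P \<inter> covered (Y - P) = {}"
      using touch by (fastforce simp: covered_def P_def)
    have "card P < card (covered P)" using pP qP q by (intro min) (auto simp: P_def)
    moreover have "card (Y - P) < card (covered (Y - P))"
      using pP qP q by (intro min) (auto simp: P_def)
    moreover have "card Y = card P + card (Y - P)"
      using fin by (metis (no_types, lifting) P_def card_Diff_subset card_mono finite_subset
          le_add_diff_inverse mem_Collect_eq subsetI)
    moreover have "card (covered Y) = card (covered P) + card (covered (Y - P))"
    proof -
      have "covered Y = covered P \<union> covered (Y - P)" by (auto simp: covered_def P_def)
      moreover have "finite (covered P)" "finite (covered (Y - P))"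
        using sub by (auto intro!: finite_covered simp: P_def)
      ultimately show ?thesis using disj by (simp add: card_Un_disjoint)
    qed
    ultimately show False using dense by linarith
  qed
  show ?thesis
    unfolding polygon_def cycle_def connected_graph_def
    using subgraph_edge_subgraph[OF sub] deg conn ne covered_eq_empty[OF sub] by simp
qed

lemma dense_contains_polygon:
  assumes "X \<subseteq> edges G" "X \<noteq> {}" "card (covered X) \<le> card X"
  shows "\<exists>Y \<subseteq> X. polygon Y"
proof -
  have "finite X" by (rule finite_edge_set[OF assms(1)])
  then show ?thesis using assms
  proof (induction X rule: finite_psubset_induct)
    case (psubset X)
    show ?case
    proof (cases "\<forall>Z. Z \<subset> X \<longrightarrow> Z \<noteq> {} \<longrightarrow> card Z < card (covered Z)")
      case True
      then have "polygon X" using psubset.prems by (intro minimal_dense_polygon) auto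
      then show ?thesis by blast
    next
      case False
      then obtain Z where Z: "Z \<subset> X" "Z \<noteq> {}" "card (covered Z) \<le> card Z"
        unfolding not_all not_imp not_less by blast
      then have "\<exists>Y \<subseteq> Z. polygon Y" using psubset.prems by (intro psubset.IH) auto
      then show ?thesis using Z by blast
    qed
  qed
qed

text \<open>By the degree sum \<open>X\<close> is dense and contains a polygon \<open>K\<close>. If
  \<open>K\<close> is not all of \<open>X\<close>, a second polygon comes from a dense set that
  omits an edge of \<open>K\<close>, or all of \<open>K\<close>.\<close>

lemma min_degree_two:
  assumes sub: "X \<subseteq> edges G" and ne: "X \<noteq> {}"
    and deg: "\<And>u. u \<in> covered X \<Longrightarrow> 2 \<le> degree (edge_subgraph G X) u"
  shows "polygon X \<or> (\<exists>C D. C \<subseteq> X \<and> D \<subseteq> X \<and> C \<noteq> D \<and> polygon C \<and> polygon D)"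
proof -
  note fin = finite_edge_set[OF sub] finite_covered[OF sub]
  have sum: "(\<Sum>u\<in>covered X. 2) \<le> (\<Sum>u\<in>covered X. degree (edge_subgraph G X) u)"
    using deg by (intro sum_mono)
  then have dense: "card (covered X) \<le> card X" using degree_sum[OF sub] by simp
  then obtain K where K: "K \<subseteq> X" "polygon K" using dense_contains_polygon[OF sub ne] by blast
  have "\<exists>D \<subseteq> X. K \<noteq> D \<and> polygon D" if "K \<noteq> X"
  proof (cases "card (covered X) = card X")
    case False
    obtain f where f: "f \<in> K" using polygonD(2)[OF K(2)] by blast
    have "card (covered (X - {f})) \<le> card (covered X)"
      using fin by (intro card_mono covered_mono) auto
    \<comment> \<open>There are strictly more edges than vertices here, so density survives the loss
      of \<open>f\<close>.\<close>
    also have "\<dots> \<le> card (X - {f})" using False dense f K fin by auto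
    finally have "card (covered (X - {f})) \<le> card (X - {f})" .
    moreover have "X - {f} \<noteq> {}" using f K that by blast
    ultimately obtain D where "D \<subseteq> X - {f}" "polygon D"
      using dense_contains_polygon[of "X - {f}"] sub by blast
    then show ?thesis using f by blast
  next
    case True
    have eq: "degree (edge_subgraph G X) u = 2" if u: "u \<in> covered X" for u
    proof (rule ccontr)
      assume "degree (edge_subgraph G X) u \<noteq> 2"
      then have "2 < degree (edge_subgraph G X) u" using deg[OF u] by simp
      then have "(\<Sum>u\<in>covered X. 2) < (\<Sum>u\<in>covered X. degree (edge_subgraph G X) u)"
        using deg u fin by (intro sum_strict_mono_ex1) auto
      then show False using degree_sum[OF sub] True by simp
    qed
    \<comment> \<open>Now \<open>X\<close> and \<open>K\<close> both have degree two at the vertices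
      of \<open>K\<close>, so no edge of \<open>X - K\<close> touches \<open>K\<close>, and
      subtracting the counts of \<open>K\<close> leaves a dense set.\<close>
    have "y \<in> K" if "y \<in> X" "u \<in> ends G y" "u \<in> covered K" for y u
      using that K sub polygonD(3)[OF K(2)] eq covered_mono[OF K(1)]
      by (intro degree_eq_imp_incident_eq[of K X u y]) auto
    then have "covered (X - K) \<subseteq> covered X - covered K" by (auto simp: covered_def)
    then have "card (covered (X - K)) \<le> card (covered X - covered K)"
      using fin by (intro card_mono) auto
    also have "\<dots> = card (covered X) - card (covered K)"
      using K(1) finite_covered[OF polygonD(1)[OF K(2)]] covered_mono by (intro card_Diff_subset) auto
    also have "\<dots> = card (X - K)"
      using True polygon_card[OF K(2)] card_Diff_subset[of K X] K fin finite_subset by metis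
    finally have "card (covered (X - K)) \<le> card (X - K)" .
    moreover have "X - K \<noteq> {}" using K that by blast
    ultimately obtain D where "D \<subseteq> X - K" "polygon D"
      using dense_contains_polygon[of "X - K"] sub by blast
    moreover have "K \<noteq> {}" using polygonD(2) K by blast
    ultimately show ?thesis by blast
  qed
  then show ?thesis using K by blast
qed

text \<open>Vertices of a cycle have degree two, so none is isolated and the vertex set is recovered
  from the edges; the end map is fixed by \<open>subgraph\<close>.\<close>

lemma cycle_edge_subgraph:
  assumes "I \<subseteq> edges G"
  shows "cycle (edge_subgraph G I) C \<longleftrightarrow>
    (\<exists>K. K \<subseteq> I \<and> polygon K \<and> C = edge_subgraph G K)"
proof
  assume cyc: "cycle (edge_subgraph G I) C"
  then have C: "graph C" "edges C \<subseteq> I" "ends C = ends G" "verts C \<subseteq> covered I"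
    "\<And>u. u \<in> verts C \<Longrightarrow> degree C u = 2" "connected_graph C"
    by (auto simp: cycle_def subgraph_def)
  have "verts C = covered (edges C)"
  proof
    show "covered (edges C) \<subseteq> verts C"
      using C graph.ends_subset by (fastforce simp: covered_def)
    show "verts C \<subseteq> covered (edges C)"
    proof
      fix u assume "u \<in> verts C"
      then have "degree C u \<noteq> 0" using C by simp
      then have "{x \<in> edges C. u \<in> ends C x} \<noteq> {} \<or> {x \<in> edges C. ends C x = {u}} \<noteq> {}"
        unfolding degree_def loops_def by (metis add_0 card.empty)
      then show "u \<in> covered (edges C)" using C by (auto simp: covered_def)
    qed
  qed
  then have eq: "C = edge_subgraph G (edges C)"
    using C by (intro graph.equality) auto
  have "subgraph C G"
    using C assms covered_subset[OF assms] by (auto simp: subgraph_def)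
  then have "cycle G C" using C by (auto simp: cycle_def)
  then have "polygon (edges C)" unfolding polygon_def using eq by simp
  then show "\<exists>K. K \<subseteq> I \<and> polygon K \<and> C = edge_subgraph G K" using eq C by blast
next
  assume "\<exists>K. K \<subseteq> I \<and> polygon K \<and> C = edge_subgraph G K"
  then obtain K where K: "K \<subseteq> I" "polygon K" "C = edge_subgraph G K" by blast
  then show "cycle (edge_subgraph G I) C"
    using covered_mono[of K I] by (auto simp: polygon_def cycle_def subgraph_def)
qed

lemma loop_polygon:
  assumes "x \<in> loops G u"
  shows "polygon {x}"
proof -
  have "x \<in> edges G" and "ends G x = {u}" using assms by (auto simp: loops_def)
  then show ?thesis
    by (intro minimal_dense_polygon) (auto simp: covered_def)
qed

section \<open>Components as reachability classes\<close>

lemma reachable_subset_verts: "u \<in> verts G \<Longrightarrow> reachable G u \<subseteq> verts G"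
proof
  fix w assume u: "u \<in> verts G" and "w \<in> reachable G u"
  then have "(u, w) \<in> (adjacent G)\<^sup>*" by (simp add: reachable_def)
  then show "w \<in> verts G"
    by (induction rule: rtrancl_induct) (use u ends_subset in \<open>auto simp: adjacent_def\<close>)
qed

lemma reachable_closed:
  assumes "x \<in> edges G" "a \<in> ends G x" "a \<in> reachable G u"
  shows "ends G x \<subseteq> reachable G u"
proof
  fix b assume b: "b \<in> ends G x"
  show "b \<in> reachable G u"
  proof (cases "a = b")
    case False
    then have "ends G x = {a, b}"
      using assms b by (intro ends_eq_pair)
    then have "(a, b) \<in> adjacent G"
      using assms by (auto simp: adjacent_def)
    then show ?thesis using assms(3) by (auto simp: reachable_def)
  qed (use assms in simp)
qed

text \<open>Links reachability to \<open>component\<close>, the notion in which framework conditions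
  (2) and (4) are stated. Maximality holds because a connected subgraph containing \<open>u\<close>
  has only vertices reachable from \<open>u\<close>.\<close>

lemma reachable_component:
  assumes u: "u \<in> verts G"
  shows "component G \<lparr>verts = reachable G u, edges = inside (reachable G u), ends = ends G\<rparr>"
    (is "component G ?H")
proof -
  have sub: "reachable G u \<subseteq> verts G" using reachable_subset_verts[OF u] .
  have gH: "graph ?H"
    using finite_subset[OF sub finite_verts] finite_edges card_ends
    by unfold_locales (auto simp: inside_def)
  have from_u: "(u, w) \<in> (adjacent ?H)\<^sup>*" if "w \<in> reachable G u" for w
  proof -
    have "(u, w) \<in> (adjacent G)\<^sup>*" using that by (simp add: reachable_def)
    then show ?thesis
    proof (induction rule: rtrancl_induct)
      case (step y z)
      have "y \<in> reachable G u" "z \<in> reachable G u"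
        using step by (auto simp: reachable_def)
      then have "(y, z) \<in> adjacent ?H"
        using step by (auto simp: adjacent_def inside_def)
      then show ?case using step by auto
    qed simp
  qed
  have "(a, b) \<in> (adjacent ?H)\<^sup>*" if "a \<in> reachable G u" "b \<in> reachable G u" for a b
    using adjacent_sym[OF from_u[OF that(1)]] from_u[OF that(2)] by (rule rtrancl_trans)
  then have "connected_graph ?H"
    using reachable_self[of u G] by (auto simp: connected_graph_def simp del: reachable_self)
  moreover have "subgraph ?H G" using gH sub by (auto simp: subgraph_def inside_def)
  moreover have "K = ?H" if K: "subgraph K G" "connected_graph K" "subgraph ?H K" for K
  proof -
    have "u \<in> verts K" using K(3) by (auto simp: subgraph_def)
    moreover have "(adjacent K)\<^sup>* \<subseteq> (adjacent G)\<^sup>*"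
      using K(1) by (intro rtrancl_mono) (auto simp: adjacent_def subgraph_def)
    ultimately have V: "verts K \<subseteq> reachable G u"
      using K(2) by (auto simp: reachable_def connected_graph_def)
    have "edges K \<subseteq> inside (reachable G u)"
      using K(1) V graph.ends_subset[of K] by (fastforce simp: subgraph_def inside_def)
    then show ?thesis
      using V K by (intro graph.equality) (auto simp: subgraph_def)
  qed
  ultimately show ?thesis by (auto simp: component_def)
qed

end


lemma (in graph) adjacent_edge_subgraph_mono:
  assumes "X \<subseteq> edges H" "ends H = ends G"
  shows "(adjacent (edge_subgraph G X))\<^sup>* \<subseteq> (adjacent H)\<^sup>*"
  using assms by (intro rtrancl_mono) (auto simp: adjacent_def)

lemma (in graph) polygon_reachable:
  assumes "polygon C" "C \<subseteq> edges H" "ends H = ends G"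
    and "a \<in> covered C" "a \<in> reachable H u"
  shows "covered C \<subseteq> reachable H u"
proof
  fix w assume "w \<in> covered C"
  then have "(a, w) \<in> (adjacent H)\<^sup>*"
    using polygonD(4)[OF assms(1,4)] adjacent_edge_subgraph_mono[OF assms(2,3)] by blast
  then show "w \<in> reachable H u"
    using assms(5) unfolding reachable_def by simp
qed

lemma (in graph) graph_delete_vertex: "graph (delete_vertex G v)"
  using finite_verts finite_edges ends_subset card_ends by unfold_locales auto

text \<open>A component is determined by its vertices and edges, its end map being that of
  \<open>G\<close>. Finiteness is what lets the bound on \<open>card\<close> in condition (4)
  exclude three distinct components, as \<open>card\<close> is 0 on infinite sets.\<close>

lemma (in graph) finite_components: "finite {H. component G H}"
proof -
  have "{H. component G H} \<subseteq>
      (\<lambda>(V, X). \<lparr>verts = V, edges = X, ends = ends G\<rparr>) ` (Pow (verts G) \<times> Pow (edges G))"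
  proof
    fix H assume "H \<in> {H. component G H}"
    then have H: "verts H \<subseteq> verts G" "edges H \<subseteq> edges G" "ends H = ends G"
      by (auto simp: component_def subgraph_def)
    then have "H = (\<lambda>(V, X). \<lparr>verts = V, edges = X, ends = ends G\<rparr>) (verts H, edges H)"
      by (intro graph.equality) auto
    then show "H \<in> (\<lambda>(V, X). \<lparr>verts = V, edges = X, ends = ends G\<rparr>) `
        (Pow (verts G) \<times> Pow (edges G))"
      using H by blast
  qed
  then show ?thesis
    using finite_verts finite_edges by (meson finite_Pow_iff finite_SigmaI finite_imageI finite_subset)
qed

section \<open>Frameworks\<close>

locale framework_matroid = graph G + matroid M
  for G :: "('v, 'e) graph" and M :: "'e matroid" +
  assumes framework: "framework G M"
begin

section \<open>The framework conditions as statements about rank\<close>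

lemma ground_eq [simp]: "ground M = edges G"
  using framework by (simp add: framework_def)

text \<open>The working form of condition (3), passed from \<open>G - u\<close> to any set of its
  edges by monotonicity of closure.\<close>

lemma not_in_closure_avoiding:
  assumes "x \<in> edges G" "u \<in> ends G x" "ends G x \<noteq> {u}"
    and "Z \<subseteq> edges G" "u \<notin> covered Z"
  shows "x \<notin> closure M Z"
proof
  assume x: "x \<in> closure M Z"
  have "Z \<subseteq> edges (delete_vertex G u)"
    using assms(4,5) by (auto simp: covered_def)
  then have "x \<in> closure M (edges (delete_vertex G u))"
    using x closure_mono by blast
  moreover have "u \<in> verts G" using assms ends_subset by blast
  ultimately have "x \<in> edges (delete_vertex G u) \<union> loops G u"
    using framework unfolding framework_def by blast
  then show False using assms by (auto simp: loops_def)
qed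

text \<open>A loop-edge at \<open>u\<close> counts twice. A non-loop \<open>x\<close> at
  \<open>u\<close> is spanned by the rest of the circuit, so by condition (3) the rest also meets
  \<open>u\<close>.\<close>

lemma circuit_degree:
  assumes "circuit M C" "u \<in> covered C"
  shows "2 \<le> degree (edge_subgraph G C) u"
proof -
  have C: "C \<subseteq> edges G" using assms by (simp add: circuit_def)
  have fin: "finite {x \<in> C. u \<in> ends G x}" "finite {x \<in> C. ends G x = {u}}"
    using finite_edge_set[OF C] by auto
  obtain x where x: "x \<in> C" "u \<in> ends G x" using assms(2) by (auto simp: covered_def)
  show ?thesis
  proof (cases "ends G x = {u}")
    case True
    have "card {x} \<le> card {x \<in> C. u \<in> ends G x}" "card {x} \<le> card {x \<in> C. ends G x = {u}}"
      using x True fin by (auto intro!: card_mono simp del: card.insert)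
    then show ?thesis by (simp add: degree_def loops_def)
  next
    case False
    have "x \<in> closure M (C - {x})" using circuit_in_closure[OF assms(1) x(1)] .
    then have "u \<in> covered (C - {x})"
      using not_in_closure_avoiding[of x u "C - {x}"] x False C by blast
    then obtain y where y: "y \<in> C" "y \<noteq> x" "u \<in> ends G y" by (auto simp: covered_def)
    have "card {x, y} \<le> card {x \<in> C. u \<in> ends G x}"
      using x y fin by (intro card_mono) auto
    then show ?thesis using y by (simp add: degree_def)
  qed
qed

text \<open>Vertices of \<open>A\<close> are reached one by one from \<open>S\<close> along edges of
  \<open>X\<close>. A newly reached vertex is not yet covered, so condition (3) makes its edge raise
  the rank. The last hypothesis says that the process never gets stuck; \<open>S\<close> need not be
  the vertex set of \<open>Z\<close>.\<close>

lemma rank_growth: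
  assumes "finite A" "S \<inter> A = {}" "Z \<subseteq> edges G" "X \<subseteq> edges G" "covered Z \<inter> A = {}"
    and "\<And>T. S \<subseteq> T \<Longrightarrow> T \<subset> S \<union> A \<Longrightarrow>
      \<exists>x \<in> X. \<exists>s \<in> T. \<exists>a \<in> (S \<union> A) - T. ends G x = {s, a}"
  shows "rank M Z + card A \<le> rank M (Z \<union> X)"
  using assms
proof (induction "card A" arbitrary: A S Z)
  case 0
  then show ?case using rank_mono[of Z "Z \<union> X"] by auto
next
  case (Suc n)
  have "A \<noteq> {}" using Suc.hyps(2) by auto
  then have "S \<subset> S \<union> A" using Suc.prems(2) by blast
  then obtain x s a where x: "x \<in> X" "s \<in> S" "a \<in> (S \<union> A) - S" "ends G x = {s, a}"
    using Suc.prems(6)[of S] by blast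
  have a: "a \<in> A" "s \<noteq> a" using x by auto
  have card: "card A = Suc (card (A - {a}))" "n = card (A - {a})"
    using a Suc.prems(1) Suc.hyps(2) by (auto simp: card_Suc_Diff1)
  \<comment> \<open>The edge \<open>x\<close> is not a loop-edge, as \<open>s\<close> differs from
    \<open>a\<close>, and \<open>Z\<close> does not cover \<open>a\<close>.\<close>
  have "x \<notin> closure M Z"
    using x a Suc.prems by (intro not_in_closure_avoiding[of x a]) auto
  then have r: "rank M (insert x Z) = Suc (rank M Z)"
    using x Suc.prems(4) by (intro rank_insert_not_closure) auto
  have union: "insert a S \<union> (A - {a}) = S \<union> A" using a by blast
  have "rank M (insert x Z) + card (A - {a}) \<le> rank M (insert x Z \<union> X)"
  proof (rule Suc.hyps(1)[OF card(2), of "insert a S"])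
    show "covered (insert x Z) \<inter> (A - {a}) = {}"
      using x Suc.prems(2,5) by (auto simp: covered_def)
    show "\<exists>x\<in>X. \<exists>s\<in>T. \<exists>b\<in>insert a S \<union> (A - {a}) - T. ends G x = {s, b}"
      if "insert a S \<subseteq> T" "T \<subset> insert a S \<union> (A - {a})" for T
      using Suc.prems(6)[of T] that unfolding union by blast
  qed (use x Suc.prems in auto)
  moreover have "insert x Z \<union> X = Z \<union> X" using x by blast
  ultimately show ?case using r card by simp
qed

lemma rank_reachable_le:
  assumes "u \<in> verts G"
  shows "rank M (inside (reachable G u)) \<le> card (reachable G u)"
proof -
  have "\<forall>H. component G H \<longrightarrow> rank M (edges H) \<le> card (verts H)"
    using framework by (simp add: framework_def)
  from this[rule_format, OF reachable_component[OF assms]] show ?thesis by simp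
qed

text \<open>Growing \<open>W\<close> to its whole component \<open>R\<close> gains at least
  \<open>card (R - W)\<close>, and condition (2) bounds the final rank by
  \<open>card R\<close>.\<close>

lemma rank_inside_le:
  assumes u: "u \<in> verts G" and W: "W \<subseteq> reachable G u"
  shows "rank M (inside W) \<le> card W"
\<comment> \<open>The growth needs a vertex to start from, so the empty set is treated
  apart.\<close>
proof (cases "W = {}")
  case True
  then have "inside W = {}" using ends_nonempty by (auto simp: inside_def)
  then show ?thesis using rank_le_card[of "{}"] by simp
next
  case False
  then obtain t where t: "t \<in> W" by blast
  let ?R = "reachable G u"
  have fin: "finite ?R" using reachable_subset_verts[OF u] finite_verts finite_subset by blast
  have "rank M (inside W) + card (?R - W) \<le> rank M (inside W \<union> inside ?R)"
  proof (rule rank_growth[where S = W])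
    show "\<exists>x\<in>inside ?R. \<exists>s\<in>T. \<exists>a\<in>W \<union> (?R - W) - T. ends G x = {s, a}"
      if T: "W \<subseteq> T" "T \<subset> W \<union> (?R - W)" for T
    proof -
      have eq: "W \<union> (?R - W) = ?R" using W by blast
      then obtain a where "a \<in> ?R" "a \<notin> T" using T by blast
      then show ?thesis
        using reachable_crossing_pair[of t G u a T] t W T(1) unfolding eq
        by (fastforce simp: inside_def)
    qed
  qed (use fin in \<open>auto simp: covered_def inside_def\<close>)
  also have "inside W \<union> inside ?R = inside ?R" using W by (auto simp: inside_def)
  finally show ?thesis
    using rank_reachable_le[OF u] card_Diff_subset[of W ?R] W fin finite_subset card_mono[of ?R W]
    by fastforce
qed

lemma rank_subset_inside_le:
  assumes "u \<in> verts G" "W \<subseteq> reachable G u" "X \<subseteq> inside W"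
  shows "rank M X \<le> card W"
  using rank_inside_le[OF assms(1,2)] rank_mono[OF assms(3)] by simp

text \<open>
  A circuit through \<open>e\<close> inside \<open>E(G - v) \<union> {e}\<close> has \<open>{e}\<close> as a component, so by the last framework
  axiom the rest of it lies in a single component of \<open>G - v\<close>.
\<close>

lemma loop_spanned_by_component:
  assumes e: "e \<in> loops G v" and indep: "indep M {e}"
    and cl: "e \<in> closure M (edges (delete_vertex G v))"
  obtains K a where "K \<subseteq> edges (delete_vertex G v)" "e \<in> closure M K" "a \<in> covered K"
    "covered K \<subseteq> reachable (delete_vertex G v) a"
proof -
  let ?D = "delete_vertex G v"
  have ends_e: "ends G e = {v}" "e \<in> edges G" using e by (auto simp: loops_def)
  then have "e \<notin> edges ?D" by simp
  then obtain Q where Q: "Q \<subseteq> insert e (edges ?D)" "e \<in> Q" "circuit M Q"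
    using closure_contains_circuit[OF cl] by blast
  define K where "K = Q - {e}"
  have K: "K \<subseteq> edges ?D" "K \<subseteq> edges G" "Q = insert e K"
    using Q by (auto simp: K_def)
  have "Q \<noteq> {e}" using Q indep by (auto simp: circuit_def)
  then have "K \<noteq> {}" using K(3) by blast
  then obtain a where a: "a \<in> covered K" using covered_eq_empty[OF K(2)] by blast
  have clK: "e \<in> closure M K"
    using circuit_in_closure[OF Q(3,2)] by (simp add: K_def)
  let ?H = "edge_subgraph G Q"
  have Qsub: "Q \<subseteq> edges G" using K ends_e by blast
  interpret H: graph ?H by (rule graph_edge_subgraph[OF Qsub])
  let ?comp = "\<lambda>u. \<lparr>verts = reachable ?H u, edges = H.inside (reachable ?H u), ends = ends ?H\<rparr>"
  have component_at: "component ?H (?comp u)" if "u \<in> covered Q" for u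
    using H.reachable_component[of u] that by (simp only: verts_edge_subgraph)
  \<comment> \<open>Only \<open>e\<close> meets \<open>v\<close> within \<open>Q\<close>, and it is
    a loop-edge, so \<open>v\<close> is a component of its own.\<close>
  have v_notin: "v \<notin> reachable ?H u" if "u \<in> covered K" for u
  proof
    assume "v \<in> reachable ?H u"
    then have "(v, u) \<in> (adjacent ?H)\<^sup>*"
      using adjacent_sym unfolding reachable_def by fast
    moreover have "u \<notin> {v}" using that K(1) by (auto simp: covered_def)
    ultimately obtain x b where "x \<in> Q" "b \<noteq> v" "ends G x = {v, b}"
      using reachable_crossing[of v "{v}" u ?H] by auto
    then show False using K(1,3) ends_e by auto
  qed
  have "w \<in> reachable ?D a" if w: "w \<in> covered K" for w
  proof -
    have connected: "w \<in> reachable ?H a"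
    proof (rule ccontr)
      \<comment> \<open>Otherwise \<open>v\<close>, \<open>a\<close> and \<open>w\<close> lie in
        three different components of \<open>G[Q]\<close>, against condition (4). They are told
        apart by their vertex sets.\<close>
      assume neg: "w \<notin> reachable ?H a"
      have "{?comp v, ?comp a, ?comp w} \<subseteq> {H'. component ?H H'}"
        using component_at a w K(3) ends_e by (auto simp: covered_def)
      then have "card {?comp v, ?comp a, ?comp w} \<le> card {H'. component ?H H'}"
        by (intro card_mono H.finite_components)
      also have "\<dots> \<le> 2" using framework Q(3) by (simp add: framework_def)
      finally have le: "card {?comp v, ?comp a, ?comp w} \<le> 2" .
      have "card {reachable ?H v, reachable ?H a, reachable ?H w} =
          card (verts ` {?comp v, ?comp a, ?comp w})"
        by simp
      also have "\<dots> \<le> card {?comp v, ?comp a, ?comp w}" by (rule card_image_le) simp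
      also note le
      finally have "card {reachable ?H v, reachable ?H a, reachable ?H w} \<le> 2" .
      moreover have "reachable ?H v \<noteq> reachable ?H a"
        using v_notin[OF a] reachable_self[of v ?H] by metis
      moreover have "reachable ?H v \<noteq> reachable ?H w"
        using v_notin[OF w] reachable_self[of v ?H] by metis
      moreover have "reachable ?H a \<noteq> reachable ?H w"
        using neg reachable_self[of w ?H] by metis
      ultimately show False by (simp add: card_insert_if)
    qed
    show ?thesis
    proof (rule ccontr)
      assume neg: "w \<notin> reachable ?D a"
      have "(a, w) \<in> (adjacent ?H)\<^sup>*" using connected by (simp add: reachable_def)
      from reachable_crossing[OF reachable_self this neg]
      obtain x t b where x: "x \<in> Q" "t \<in> reachable ?D a" "b \<notin> reachable ?D a"
        "ends G x = {t, b}"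
        unfolding edge_subgraph_sel by blast
      \<comment> \<open>The ends of \<open>x\<close> are distinct, so \<open>x\<close> is an edge of
        \<open>G - v\<close>, and the step would not leave the component of \<open>a\<close>
        there.\<close>
      have "x \<noteq> e" using x ends_e by auto
      then have "x \<in> edges ?D" using x K(1,3) by blast
      then have "(t, b) \<in> adjacent ?D" using x by (auto simp: adjacent_def)
      then show False
        using x(2,3) rtrancl.rtrancl_into_rtrancl[of a t _ b] by (simp add: reachable_def)
    qed
  qed
  then show thesis using that[OF K(1) clK a] by blast
qed

text \<open>
  Adding the vertices of \<open>A\<close> one at a time to the rest of the graph raises the rank by \<open>|A|\<close>,
  while \<open>X\<close> has rank at most \<open>|A| + 1\<close>; if \<open>v\<close> has no neighbour in \<open>A\<close>, both bounds drop by one.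
\<close>

lemma component_separation:
  assumes v: "v \<in> verts G" and a: "a \<in> verts G" "a \<noteq> v"
    and A_def: "A = reachable (delete_vertex G v) a"
    and X_def: "X = {x \<in> edges G. ends G x \<inter> A \<noteq> {}}"
  shows "rank M X + rank M (edges G - X) \<le> rank M (edges G) + 1"
proof -
  let ?D = "delete_vertex G v" and ?Y = "edges G - X"
  interpret D: graph ?D by (rule graph_delete_vertex)
  have A: "A \<subseteq> verts G - {v}" "a \<in> A"
    using D.reachable_subset_verts[of a] a by (auto simp: A_def)
  then have finA: "finite A" using finite_verts finite_subset by blast
  have XY: "X \<subseteq> edges G" "?Y \<union> X = edges G" "covered ?Y \<inter> A = {}"
    by (auto simp: X_def covered_def)
  have A_reach: "A \<subseteq> reachable G a"
    unfolding A_def by (rule reachable_delete_vertex_subset)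
  have closed: "ends G x \<subseteq> A" if "x \<in> edges G" "v \<notin> ends G x" "ends G x \<inter> A \<noteq> {}" for x
    using D.reachable_closed[of x _ a] that by (auto simp: A_def)
  have cross: "\<exists>x\<in>X. \<exists>s\<in>T. \<exists>b\<in>A - T. ends G x = {s, b}"
    if t: "t \<in> A" "t \<in> T" and b: "b \<in> A" "b \<notin> T" for T t b
  proof -
    obtain x s c where "x \<in> edges ?D" "s \<in> T" "c \<in> A - T" "ends G x = {s, c}"
      using reachable_crossing_pair[of t ?D a b T] t b by (auto simp: A_def)
    then show ?thesis by (intro bexI[of _ x]) (auto simp: X_def)
  qed
  show ?thesis
  proof (cases "\<exists>g \<in> edges G. v \<in> ends G g \<and> ends G g \<inter> A \<noteq> {}")
    case True
    then obtain g b where g: "g \<in> edges G" "v \<in> ends G g" "b \<in> ends G g" "b \<in> A" by blast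
    then have ends_g: "ends G g = {v, b}" using A by (intro ends_eq_pair) auto
    have "v \<in> reachable G a" using reachable_closed[of g b a] g A_reach by blast
    moreover have "X \<subseteq> inside (insert v A)"
    proof
      fix x assume x: "x \<in> X"
      show "x \<in> inside (insert v A)"
      proof (cases "v \<in> ends G x")
        case True
        then obtain c where "c \<in> ends G x" "c \<in> A" using x by (auto simp: X_def)
        then have "ends G x = {v, c}" using True x A by (intro ends_eq_pair) (auto simp: X_def)
        then show ?thesis using x \<open>c \<in> A\<close> by (auto simp: inside_def X_def)
      qed (use closed x in \<open>auto simp: X_def inside_def\<close>)
    qed
    ultimately have "rank M X \<le> card (insert v A)"
      using a A_reach by (intro rank_subset_inside_le[of a]) auto
    moreover have "card (insert v A) = card A + 1" using A finA by (auto simp: card_insert_if)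
    moreover have "rank M ?Y + card A \<le> rank M (?Y \<union> X)"
    proof (rule rank_growth[where S = "verts G - A"])
      show "\<exists>x\<in>X. \<exists>s\<in>T. \<exists>b\<in>verts G - A \<union> A - T. ends G x = {s, b}"
        if T: "verts G - A \<subseteq> T" "T \<subset> verts G - A \<union> A" for T
      proof (cases "A \<inter> T = {}")
        \<comment> \<open>Nothing of \<open>A\<close> is reached yet, so the growth enters
          \<open>A\<close> from \<open>v\<close> along \<open>g\<close>.\<close>
        case True
        then have "v \<in> T" "b \<in> A - T" "g \<in> X"
          using T v A g by (auto simp: X_def)
        then show ?thesis using ends_g by blast
      next
        case False
        then obtain t where "t \<in> A" "t \<in> T" by blast
        moreover obtain c where "c \<in> A" "c \<notin> T" using T by blast
        ultimately show ?thesis using cross[of t T c] by blast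
      qed
    qed (use finA XY in auto)
    ultimately show ?thesis using XY(2) by simp
  next
    case False
    then have "X \<subseteq> inside A" using closed by (auto simp: X_def inside_def)
    then have "rank M X \<le> card A"
      using a A_reach by (intro rank_subset_inside_le[of a])
    \<comment> \<open>No edge enters \<open>A\<close> from outside, so \<open>a\<close> is put among
      the starting vertices; this costs one in the growth and is made up by the better bound on the
      rank of \<open>X\<close>.\<close>
    moreover have "card A = card (A - {a}) + 1" using card.remove[OF finA A(2)] by simp
    moreover have "rank M ?Y + card (A - {a}) \<le> rank M (?Y \<union> X)"
    proof (rule rank_growth[where S = "insert a (verts G - A)"])
      show "\<exists>x\<in>X. \<exists>s\<in>T. \<exists>b\<in>insert a (verts G - A) \<union> (A - {a}) - T. ends G x = {s, b}"
        if T: "insert a (verts G - A) \<subseteq> T" "T \<subset> insert a (verts G - A) \<union> (A - {a})" for T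
      proof -
        obtain c where "c \<in> A" "c \<notin> T" using T by blast
        then have "\<exists>x\<in>X. \<exists>s\<in>T. \<exists>b\<in>A - T. ends G x = {s, b}"
          using cross[of a T c] A T by blast
        then show ?thesis by blast
      qed
    qed (use finA XY in auto)
    ultimately show ?thesis using XY(2) by simp
  qed
qed

text \<open>An independent polygon has rank equal to its number of vertices, so \<open>e\<close> is
  spanned once \<open>insert e C\<close> has no larger rank. The cases are that \<open>C\<close>
  passes through \<open>v\<close>, lies in the component \<open>A\<close> of \<open>G - v\<close>
  that spans \<open>e\<close>, or avoids both.\<close>

lemma loop_in_closure_polygon:
  assumes conn: "connected_matroid 3 M"
    and e: "e \<in> loops G v" and indep_e: "indep M {e}"
    and cl: "e \<in> closure M (edges (delete_vertex G v))"
    and C: "polygon C" and indep_C: "indep M C"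
  shows "e \<in> closure M C"
proof -
  let ?D = "delete_vertex G v"
  have ends_e: "ends G e = {v}" "e \<in> edges G" using e by (auto simp: loops_def)
  have v: "v \<in> verts G" using ends_e ends_subset by blast
  have C_edges: "C \<subseteq> edges G" and C_ne: "C \<noteq> {}" using polygonD[OF C] by auto
  have rank_C: "rank M C = card (covered C)"
    using rank_indep[OF indep_C] polygon_card[OF C] by simp
  have by_rank: "e \<in> closure M C" if "rank M (insert e C) \<le> card (covered C)"
    using that rank_C rank_mono[OF subset_insertI, of C e] ends_e by (auto simp: closure_def)
  obtain K a where K: "K \<subseteq> edges ?D" "e \<in> closure M K" "a \<in> covered K"
    "covered K \<subseteq> reachable ?D a"
    using loop_spanned_by_component[OF e indep_e cl] .
  define A where "A = reachable ?D a"
  interpret D: graph ?D by (rule graph_delete_vertex)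
  have a: "a \<in> verts G" "a \<noteq> v" using K(1,3) ends_subset by (auto simp: covered_def)
  have A: "A \<subseteq> verts G - {v}"
    using D.reachable_subset_verts[of a] a by (auto simp: A_def)
  then have finA: "finite A" using finite_verts finite_subset by blast
  have K_inside: "K \<subseteq> inside A" using K(1,4) by (auto simp: inside_def covered_def A_def)
  show ?thesis
  proof (cases "v \<in> covered C")
    case True
    \<comment> \<open>Here \<open>e\<close> brings no new vertex.\<close>
    have "insert e C \<subseteq> inside (covered C)"
      using True ends_e subset_inside_covered[OF C_edges] by (auto simp: inside_def)
    moreover have "covered C \<subseteq> reachable G v"
      using True C_edges by (intro polygon_reachable[OF C, of G v]) auto
    ultimately show ?thesis
      using v by (intro by_rank rank_subset_inside_le[of v])
  next
    case v_notin: False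
    then have C_D: "C \<subseteq> edges ?D" using C_edges by (auto simp: covered_def)
    show ?thesis
    proof (cases "covered C \<inter> A = {}")
      case False
      then obtain t where t: "t \<in> covered C" "t \<in> A" by blast
      then have CA: "covered C \<subseteq> A"
        unfolding A_def using C_D by (intro polygon_reachable[OF C, of ?D t]) auto
      \<comment> \<open>The loop-edge \<open>e\<close> covers only \<open>v\<close>, which is
        outside \<open>A\<close>, so it may be present from the start. At the end it is spanned by
        \<open>inside A\<close>, whose rank is at most \<open>card A\<close>.\<close>
      have "rank M (insert e C) + card (A - covered C) \<le> rank M (insert e C \<union> inside A)"
      proof (rule rank_growth[where S = "covered C"])
        show "\<exists>x\<in>inside A. \<exists>s\<in>T. \<exists>b\<in>covered C \<union> (A - covered C) - T. ends G x = {s, b}"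
          if T: "covered C \<subseteq> T" "T \<subset> covered C \<union> (A - covered C)" for T
        proof -
          have eq: "covered C \<union> (A - covered C) = A" using CA by blast
          then obtain b where "b \<in> A" "b \<notin> T" using T by blast
          then show ?thesis
            using reachable_crossing_pair[of t ?D a b T] t T(1) unfolding eq
            by (fastforce simp: inside_def A_def)
        qed
        show "covered (insert e C) \<inter> (A - covered C) = {}"
          using ends_e A by (auto simp: covered_def)
      qed (use finA C_edges ends_e in \<open>auto simp: inside_def\<close>)
      also have "insert e C \<union> inside A = insert e (inside A)"
        using CA C_edges by (auto simp: inside_def covered_def)
      also have "rank M (insert e (inside A)) = rank M (inside A)"
        using closure_mono[OF K_inside] K(2) by (auto simp: closure_def)
      also have "\<dots> \<le> card A"
        using a reachable_delete_vertex_subset[of G v a] by (intro rank_inside_le[of a]) (auto simp: A_def)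
      also have "card A = card (A - covered C) + card (covered C)"
        using CA finA finite_subset[OF CA finA] card_Diff_subset[of "covered C" A] card_mono[of A "covered C"]
        by simp
      finally show ?thesis by (intro by_rank) simp
    next
      case True
      show ?thesis
      proof (rule ccontr)
        assume neg: "e \<notin> closure M C"
        define X where "X = {x \<in> edges G. ends G x \<inter> A \<noteq> {}}"
        have sep: "rank M X + rank M (edges G - X) \<le> rank M (edges G) + 1"
          using component_separation[OF v a A_def X_def] .
        have KX: "K \<subseteq> X" "K \<noteq> {}"
          using K_inside ends_nonempty K(3) by (fastforce simp: X_def inside_def, auto simp: covered_def)
        have finX: "finite X" "X \<subseteq> edges G" using finite_edges by (auto simp: X_def)
        have eX: "e \<notin> X" using ends_e A by (auto simp: X_def)
        have CX: "C \<inter> X = {}" using True by (auto simp: X_def covered_def)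
        have eC: "e \<notin> C" using C_D ends_e by auto
        have no_sep: "\<not> separation M k Z" if "k = 1 \<or> k = 2" for k Z
          using conn that unfolding connected_matroid_def by auto
        show False
        proof (cases "2 \<le> card X")
          case True
          obtain c where "c \<in> C" using C_ne by blast
          \<comment> \<open>Both \<open>e\<close> and the polygon avoid \<open>A\<close>, so the
            complement of \<open>X\<close> is large enough for a 2-separation.\<close>
          then have "{e, c} \<subseteq> edges G - X" "e \<noteq> c" using eX CX eC C_edges ends_e by auto
          then have "2 \<le> card (edges G - X)"
            using card_mono[of "edges G - X" "{e, c}"] finite_edges by simp
          then have "separation M 2 X" using True sep finX by (simp add: separation_def)
          then show False using no_sep by blast
        next
          case False
          \<comment> \<open>A single edge is too small a side for a 2-separation. As
            \<open>X\<close> spans \<open>e\<close>, moving \<open>e\<close> across gives a side of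
            size two without changing its rank.\<close>
          let ?Y = "edges G - insert e X"
          have "0 < card X" using KX finX by (auto simp: card_gt_0_iff)
          then have card_X: "card X = 1" using False by simp
          have card_eX: "card (insert e X) = 2" using card_X eX finX by simp
          have "e \<in> closure M X" using closure_mono[OF KX(1)] K(2) by blast
          then have rank_eX: "rank M (insert e X) = rank M X" by (simp add: closure_def)
          have C_Y: "C \<subseteq> ?Y" using C_edges CX eC by blast
          have "rank M ?Y \<le> rank M (edges G - X)" by (intro rank_mono) auto
          then have "\<not> 2 \<le> card ?Y"
            using no_sep[of 2 "insert e X"] sep rank_eX card_eX finX ends_e
            by (auto simp: separation_def)
          moreover have "card C \<le> card ?Y" "0 < card C"
            using C_Y C_ne finite_edges finite_edge_set[OF C_edges]
            by (auto intro: card_mono simp: card_gt_0_iff)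
          ultimately have card_C: "card C = 1" "card ?Y = card C" by auto
          then have Y_eq: "?Y = C" using C_Y finite_edges card_seteq[of ?Y C] by auto
          have "rank M (insert e C) = Suc (rank M C)"
            using neg ends_e by (intro rank_insert_not_closure) auto
          \<comment> \<open>The complement is now the single edge of \<open>C\<close>. Both sides
            have rank at most one, so total rank two yields a 1-separation.\<close>
          then have "2 \<le> rank M (edges G)"
            using rank_mono[of "insert e C" "edges G"] C_edges ends_e card_C rank_indep[OF indep_C]
            by simp
          moreover have "rank M (insert e X) \<le> 1" "rank M ?Y \<le> 1"
            using rank_eX rank_le_card[of X] finX card_X Y_eq rank_indep[OF indep_C] card_C by auto
          ultimately have "separation M 1 (insert e X)"
            using card_eX card_C finX ends_e by (simp add: separation_def)
          then show False using no_sep by blast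
        qed
      qed
    qed
  qed
qed

text \<open>If the polygons meet, their union has more edges than vertices, hence more than its
  rank. If they are disjoint, both span \<open>e\<close>, and submodularity puts the rank of the
  union below the sum of their sizes.\<close>

lemma indep_polygons_eq:
  assumes conn: "connected_matroid 3 M"
    and e: "e \<in> loops G v" and indep_e: "indep M {e}"
    and cl: "e \<in> closure M (edges (delete_vertex G v))"
    and I: "indep M I" and C: "polygon C" "C \<subseteq> I" and D: "polygon D" "D \<subseteq> I"
  shows "C = D"
proof (rule ccontr)
  assume neq: "C \<noteq> D"
  have ind: "indep M C" "indep M D" "indep M (C \<union> D)"
    using C D by (auto intro: indep_subset[OF I])
  have sub: "C \<subseteq> edges G" "D \<subseteq> edges G" using polygonD(1) C D by auto
  note fin = finite_edge_set[OF sub(1)] finite_edge_set[OF sub(2)]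
  show False
  proof (cases "covered C \<inter> covered D = {}")
    case False
    then obtain u where u: "u \<in> covered C" "u \<in> covered D" by blast
    have "covered (C \<union> D) \<subseteq> reachable G u"
      unfolding covered_Un
      using polygon_reachable[OF C(1) sub(1) refl u(1)] polygon_reachable[OF D(1) sub(2) refl u(2)]
      by simp
    then have "rank M (C \<union> D) \<le> card (covered (C \<union> D))"
      using u covered_subset[OF sub(1)] subset_inside_covered[of "C \<union> D"] sub
      by (intro rank_subset_inside_le[of u]) auto
    then show False
      using intersecting_polygons[OF C(1) D(1) neq False] rank_indep[OF ind(3)] by simp
  next
    case True
    have "C \<inter> D = {}"
      using True sub ends_nonempty by (fastforce simp: covered_def)
    then have "card (C \<union> D) = card C + card D" using fin by (simp add: card_Un_disjoint)
    then have "rank M (C \<union> D) = card C + card D" using rank_indep[OF ind(3)] by simp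
    moreover have "rank M (C \<union> D) \<le> rank M (insert e C \<union> insert e D)"
      by (intro rank_mono) auto
    \<comment> \<open>Adding \<open>e\<close> to both sides leaves their ranks unchanged but gives
      the intersection rank at least one.\<close>
    moreover have "card {e} \<le> rank M (insert e C \<inter> insert e D)"
      by (intro card_le_rank indep_e) auto
    moreover have "rank M (insert e C) = card C" "rank M (insert e D) = card D"
      using loop_in_closure_polygon[OF conn e indep_e cl] C(1) D(1) ind(1,2)
      by (auto simp: closure_def rank_indep)
    ultimately show False using rank_submodular[of "insert e C" "insert e D"] by simp
  qed
qed

text \<open>A circuit inside \<open>I\<close> has minimum degree two, so it is itself a polygon,
  hence balanced, or contains two polygons.\<close>

lemma dependent_contains_cycles:
  assumes "I \<subseteq> edges G" "\<not> indep M I"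
  shows "(\<exists>C \<subseteq> I. polygon C \<and> circuit M C) \<or>
    (\<exists>C D. C \<subseteq> I \<and> D \<subseteq> I \<and> C \<noteq> D \<and> polygon C \<and> polygon D)"
proof -
  obtain Q where Q: "Q \<subseteq> I" "circuit M Q"
    using dependent_contains_circuit[of I] assms by auto
  have "Q \<noteq> {}" using Q indep_empty by (auto simp: circuit_def)
  then have "polygon Q \<or> (\<exists>C D. C \<subseteq> Q \<and> D \<subseteq> Q \<and> C \<noteq> D \<and> polygon C \<and> polygon D)"
    using Q assms(1) circuit_degree[OF Q(2)] by (intro min_degree_two) auto
  then show ?thesis
  proof
    assume "polygon Q"
    then show ?thesis using Q by (intro disjI1 exI[of _ Q]) simp
  next
    assume "\<exists>C D. C \<subseteq> Q \<and> D \<subseteq> Q \<and> C \<noteq> D \<and> polygon C \<and> polygon D"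
    then show ?thesis using Q(1) by (intro disjI2) (meson order_trans)
  qed
qed

end

theorem theorem7p1:
  fixes G :: "('v, 'e) graph" and M :: "'e matroid" and e :: 'e and v :: 'v
  assumes "graph G"
    and "matroid M"
    and "connected_matroid 3 M"
    and "framework G M"
    and "e \<in> loops G v"
    and "\<not> balanced_cycle G M (edge_subgraph G {e})"
    and "e \<in> closure M (edges (delete_vertex G v))"
  shows "{I. indep M I} =
    {I. I \<subseteq> edges G \<and>
        \<not> (\<exists>C. balanced_cycle (edge_subgraph G I) M C) \<and>
        (\<forall>C D. cycle (edge_subgraph G I) C \<and> cycle (edge_subgraph G I) D \<longrightarrow> C = D)}"
proof -
  interpret framework_matroid G M
    using assms(1,2,4) by (intro framework_matroid.intro framework_matroid_axioms.intro)
  \<comment> \<open>If \<open>{e}\<close> were dependent it would be a circuit, and the loop-edge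
    would form a balanced cycle.\<close>
  have indep_e: "indep M {e}"
  proof (rule ccontr)
    assume "\<not> indep M {e}"
    then have "circuit M {e}"
      using assms(5) indep_empty by (auto simp: circuit_def loops_def subset_singleton_iff psubset_eq)
    then show False
      using loop_polygon[OF assms(5)] assms(6) by (simp add: polygon_def balanced_cycle_def)
  qed
  have balanced: "balanced_cycle (edge_subgraph G I) M C \<longleftrightarrow>
      (\<exists>K \<subseteq> I. polygon K \<and> circuit M K \<and> C = edge_subgraph G K)" if "I \<subseteq> edges G" for I C
    using cycle_edge_subgraph[OF that, of C] by (auto simp: balanced_cycle_def)
  have "indep M I \<longleftrightarrow> I \<subseteq> edges G \<and>
      \<not> (\<exists>C. balanced_cycle (edge_subgraph G I) M C) \<and>
      (\<forall>C D. cycle (edge_subgraph G I) C \<and> cycle (edge_subgraph G I) D \<longrightarrow> C = D)" (is "_ \<longleftrightarrow> ?R")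
    for I
  proof
    assume I: "indep M I"
    then have sub: "I \<subseteq> edges G" using indep_subset_ground by fastforce
    moreover have "\<not> balanced_cycle (edge_subgraph G I) M C" for C
      using balanced[OF sub] indep_subset[OF I] by (auto simp: circuit_def)
    moreover have "C = D"
      if "cycle (edge_subgraph G I) C" "cycle (edge_subgraph G I) D" for C D
      using that indep_polygons_eq[OF assms(3,5) indep_e assms(7) I]
      unfolding cycle_edge_subgraph[OF sub] by blast
    ultimately show ?R by blast
  next
    assume R: ?R
    then have sub: "I \<subseteq> edges G" by blast
    show "indep M I"
    proof (rule ccontr)
      assume "\<not> indep M I"
      from dependent_contains_cycles[OF sub this] show False
      proof (elim disjE exE conjE)
        fix C assume "C \<subseteq> I" "polygon C" "circuit M C"
        then show False using R balanced[OF sub] by blast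
      next
        fix C D assume "C \<subseteq> I" "D \<subseteq> I" "C \<noteq> D" "polygon C" "polygon D"
        \<comment> \<open>The uniqueness hypothesis concerns subgraphs; equal subgraphs have equal
          edge sets.\<close>
        then have "edge_subgraph G C = edge_subgraph G D"
          using R cycle_edge_subgraph[OF sub] by blast
        then show False using \<open>C \<noteq> D\<close> edge_subgraph_sel(1) by metis
      qed
    qed
  qed
  then show ?thesis by blast
qed

end
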